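(* Let $F$ be the face $(U_{3,4},U_{1,2}^{12})$ of $\Gamma_4$. For real $a,b\ge 0$, the point $\mathbf h=(a,b)\in F$ is entropic if and only if $a=\log v$ for some integer $v\ge 1$.
   Context: $N_4=\{1,2,3,4\}$. $\Gamma_4$ is the cone of all polymatroid rank functions on $N_4$. A set function $\mathbf h:2^{N_4}\to\mathbb R$ is called entropic if there is a random vector $(X_1,X_2,X_3,X_4)$, each $X_i$ taking values in a finite set, with $\mathbf h(A)=H(X_A)$ for all $A\subseteq N_4$, where $H$ is Shannon entropy, $X_A=(X_j,j\in A)$ and $\mathbf h(\emptyset)=0$. Logarithms (also in the entropy) are to base $2$. For two (poly)matroids $M_1,M_2$ on $N_4$ with rank functions $\mathbf r_1,\mathbf r_2$, $(M_1,M_2)$ denotes the face $\{a\mathbf r_1+b\mathbf r_2:a,b\ge0\}$ of $\Gamma_4$, and $(a,b)$ denotes the point $a\mathbf r_1+b\mathbf r_2$. $U_{3,4}$ is the uniform matroid on $N_4$ with $\mathbf r(A)=\min\{3,|A|\}$; $U^{12}_{1,2}$ is the matroid on $N_4$ with $\mathbf r(A)=\min\{1,|A\cap\{1,2\}|\}$. *)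

theory Defs
  imports "HOL-Probability.Probability"
begin

text \<open>
  The ground set \<open>N\<^sub>4 = {1,2,3,4}\<close> is the universe of the numeral type \<^typ>\<open>4\<close> (there the
  numerals \<open>1,2,3,4\<close> are pairwise distinct and exhaust the type, \<open>4\<close> being \<open>0\<close>), so that set
  functions on \<open>2\<^bsup>N\<^sub>4\<^esup>\<close> are exactly the elements of \<^typ>\<open>4 set \<Rightarrow> real\<close>.
\<close>

definition Gamma4 :: "(4 set \<Rightarrow> real) set" where
  "Gamma4 = {h. h {} = 0 \<and> (\<forall>A B. A \<subseteq> B \<longrightarrow> h A \<le> h B) \<and>
                (\<forall>A B. h (A \<union> B) + h (A \<inter> B) \<le> h A + h B)}"

definition face_point ::
    "(4 set \<Rightarrow> real) \<Rightarrow> (4 set \<Rightarrow> real) \<Rightarrow> real \<Rightarrow> real \<Rightarrow> 4 set \<Rightarrow> real" where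
  "face_point r1 r2 a b = (\<lambda>A. a * r1 A + b * r2 A)"

definition face :: "(4 set \<Rightarrow> real) \<Rightarrow> (4 set \<Rightarrow> real) \<Rightarrow> (4 set \<Rightarrow> real) set" where
  "face r1 r2 = {face_point r1 r2 a b | a b. 0 \<le> a \<and> 0 \<le> b}"

definition U_3_4 :: "4 set \<Rightarrow> real" where
  "U_3_4 A = real (min 3 (card A))"

definition U_1_2_12 :: "4 set \<Rightarrow> real" where
  "U_1_2_12 A = real (min 1 (card (A \<inter> {1, 2})))"

definition subvector :: "(4 \<Rightarrow> 'w \<Rightarrow> 'v) \<Rightarrow> 4 set \<Rightarrow> 'w \<Rightarrow> (4 \<Rightarrow> 'v)" where
  "subvector X A = (\<lambda>\<omega>. \<lambda>i\<in>A. X i \<omega>)"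

text \<open>
  The sample space and the alphabets are taken inside \<^typ>\<open>nat\<close>, because HOL cannot quantify
  existentially over types; the lemma \<open>entropicI\<close> below shows that this loses no
  generality.  \<^term>\<open>h {} = 0\<close> is implied, \<^term>\<open>subvector X {}\<close> being constant.
\<close>

definition entropic :: "(4 set \<Rightarrow> real) \<Rightarrow> bool" where
  "entropic h \<longleftrightarrow>
     (\<exists>(M :: nat measure) (X :: 4 \<Rightarrow> nat \<Rightarrow> nat).
        prob_space M \<and> (\<forall>i. simple_function M (X i)) \<and>
        (\<forall>A. h A = prob_space.entropy M 2
                     (count_space (subvector X A ` space M)) (subvector X A)))"

lemma simple_function_subvector:
  fixes X :: "4 \<Rightarrow> 'w \<Rightarrow> 'v"
  assumes X: "\<And>i. simple_function M (X i)"
  shows "simple_function M (subvector X A)"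
proof -
  let ?g = "\<lambda>(p, q, r, s). \<lambda>i\<in>A. if i = 1 then p else if i = 2 then q else if i = 3 then r else s"
  have sf: "simple_function M (\<lambda>w. (X 1 w, X 2 w, X 3 w, X 4 w))"
    by (intro simple_function_Pair X)
  have "subvector X A w i = ?g (X 1 w, X 2 w, X 3 w, X 4 w) i" for w i
    using exhaust_4[of i] unfolding subvector_def by (elim disjE) simp_all
  then have "subvector X A = ?g \<circ> (\<lambda>w. (X 1 w, X 2 w, X 3 w, X 4 w))"
    unfolding comp_def by (intro ext)
  then show ?thesis
    using simple_function_compose[OF sf, of ?g] by argo
qed

lemma entropicI:
  fixes M :: "'w measure" and X :: "4 \<Rightarrow> 'w \<Rightarrow> 'v"
  assumes M: "prob_space M" and X: "\<And>i. simple_function M (X i)"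
    and h: "\<And>A. h A = prob_space.entropy M 2
                   (count_space (subvector X A ` space M)) (subvector X A)"
  shows "entropic h"
proof -
  interpret information_space M 2
    using M by (simp add: information_space_def information_space_axioms_def)
  define V where "V = (\<Union>i. X i ` space M)"
  have "finite V"
    unfolding V_def using X by (auto dest: simple_functionD)
  then obtain enc :: "'v \<Rightarrow> nat" where enc: "inj_on enc V"
    using finite_imp_inj_to_nat_seg by metis
  define f :: "'w \<Rightarrow> nat" where "f w = to_nat (\<lambda>i. enc (X i w))" for w
  define M' where "M' = distr M (count_space (f ` space M)) f"
  define X' :: "4 \<Rightarrow> nat \<Rightarrow> nat" where "X' i n = (from_nat n :: 4 \<Rightarrow> nat) i" for i n
  have f_alt: "f = (\<lambda>v. to_nat (\<lambda>i. enc (v i))) \<circ> subvector X UNIV"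
    by (auto simp: f_def subvector_def fun_eq_iff)
  have sf: "simple_function M f"
    unfolding f_alt by (intro simple_function_compose simple_function_subvector X)
  have meas: "f \<in> measurable M (count_space (f ` space M))"
    using simple_functionD[OF sf] by (auto simp: measurable_count_space_eq2)
  have ps: "prob_space M'"
    unfolding M'_def using meas by (rule prob_space_distr)
  have sp: "space M' = f ` space M" by (simp add: M'_def)
  have fin: "finite (f ` space M)" using sf by (rule simple_functionD)
  have sX': "simple_function M' (X' i)" for i
    unfolding simple_function_def sp using fin by (auto simp: M'_def)
  have comp: "subvector X' A (f w) = (\<lambda>v. \<lambda>i\<in>A. enc (v i)) (subvector X A w)" for A w
    by (auto simp: subvector_def X'_def f_def fun_eq_iff)
  have "h A = prob_space.entropy M' 2
                (count_space (subvector X' A ` space M')) (subvector X' A)" for A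
  proof -
    let ?g = "\<lambda>v. \<lambda>i\<in>A. enc (v i)"
    have inj: "inj_on ?g (subvector X A ` space M)"
    proof (rule inj_onI, clarify)
      fix w w' assume w: "w \<in> space M" "w' \<in> space M"
        and eq: "?g (subvector X A w) = ?g (subvector X A w')"
      have "X i w = X i w'" if "i \<in> A" for i
      proof -
        have "enc (X i w) = enc (X i w')"
          using fun_cong[OF eq, of i] that by (simp add: subvector_def)
        then show ?thesis using enc w by (auto simp: V_def inj_on_def)
      qed
      then show "subvector X A w = subvector X A w'"
        by (auto simp: subvector_def fun_eq_iff)
    qed
    have eqc: "?g \<circ> subvector X A = subvector X' A \<circ> f"
      by (auto simp: comp fun_eq_iff)
    have img: "subvector X' A ` space M' = (?g \<circ> subvector X A) ` space M"
      unfolding eqc sp by (simp add: image_comp)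
    have "distr M' (count_space (subvector X' A ` space M')) (subvector X' A)
        = distr M (count_space (subvector X' A ` space M')) (subvector X' A \<circ> f)"
      unfolding M'_def by (rule distr_distr[OF _ meas]) (auto simp: space_distr)
    then have "prob_space.entropy M' 2 (count_space (subvector X' A ` space M')) (subvector X' A)
        = entropy 2 (count_space (subvector X' A ` space M')) (?g \<circ> subvector X A)"
      by (simp add: prob_space.entropy_def[OF ps] entropy_def eqc)
    also have "\<dots> = h A"
      unfolding img h by (rule entropy_of_inj[OF simple_function_subvector[OF X] inj])
    finally show ?thesis ..
  qed
  with ps sX' show ?thesis unfolding entropic_def by blast
qed

text \<open>The cone \<^term>\<open>face U_3_4 U_1_2_12\<close> is indeed a face of the cone \<^term>\<open>Gamma4\<close>.\<close>

lemma subset_4_cases: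
  fixes A :: "4 set"
  assumes "P {}" "P {1}" "P {2}" "P {3}" "P {4}" "P {1,2}"
      "P {1,3}" "P {1,4}" "P {2,3}" "P {2,4}" "P {3,4}" "P {1,2,3}"
      "P {1,2,4}" "P {1,3,4}" "P {2,3,4}" "P {1,2,3,4}"
  shows "P A"
proof -
  have "A \<in> Pow {1,2,3,4}" using UNIV_4 by auto
  then show ?thesis
    by (simp only: Pow_insert Pow_empty image_insert image_empty image_Un Un_iff insert_iff
        empty_iff simp_thms) (elim disjE; simp only: assms)
qed

lemma face_subset_Gamma4: "face U_3_4 U_1_2_12 \<subseteq> Gamma4"
proof -
  have sub: "real (min k (card ((A \<union> B) \<inter> S))) + real (min k (card (A \<inter> B \<inter> S)))
      \<le> real (min k (card (A \<inter> S))) + real (min k (card (B \<inter> S)))" for k and A B S :: "4 set"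
  proof -
    have "card ((A \<union> B) \<inter> S) + card (A \<inter> B \<inter> S) = card (A \<inter> S) + card (B \<inter> S)"
    proof -
      have "(A \<union> B) \<inter> S = A \<inter> S \<union> B \<inter> S" "A \<inter> B \<inter> S = (A \<inter> S) \<inter> (B \<inter> S)" by blast+
      then show ?thesis using card_Un_Int[of "A \<inter> S" "B \<inter> S"] by simp
    qed
    moreover have "card (A \<inter> B \<inter> S) \<le> card (A \<inter> S)" "card (A \<inter> B \<inter> S) \<le> card (B \<inter> S)"
      by (auto intro!: card_mono)
    ultimately show ?thesis by (simp add: min_def)
  qed
  have "face_point U_3_4 U_1_2_12 a b \<in> Gamma4" if "0 \<le> a" "0 \<le> b" for a b
  proof -
    have sU: "U_3_4 (A \<union> B) + U_3_4 (A \<inter> B) \<le> U_3_4 A + U_3_4 B" for A B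
      using sub[of 3 A B UNIV] by (simp only: U_3_4_def Int_UNIV_right)
    have sU': "U_1_2_12 (A \<union> B) + U_1_2_12 (A \<inter> B) \<le> U_1_2_12 A + U_1_2_12 B" for A B
      using sub[of 1 A B "{1,2}"] by (simp only: U_1_2_12_def)
    have mU: "U_3_4 A \<le> U_3_4 B" if "A \<subseteq> B" for A B
      using card_mono[OF finite that] by (simp add: U_3_4_def)
    have mU': "U_1_2_12 A \<le> U_1_2_12 B" if "A \<subseteq> B" for A B
      using card_mono[of "B \<inter> {1,2}" "A \<inter> {1,2}"] Int_mono[OF that order_refl]
      by (simp only: U_1_2_12_def of_nat_le_iff finite simp_thms min.mono)
    have "a * (U_3_4 (A \<union> B) + U_3_4 (A \<inter> B)) + b * (U_1_2_12 (A \<union> B) + U_1_2_12 (A \<inter> B))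
        \<le> a * (U_3_4 A + U_3_4 B) + b * (U_1_2_12 A + U_1_2_12 B)" for A B
      using that by (intro add_mono mult_left_mono sU sU')
    moreover have "a * U_3_4 A + b * U_1_2_12 A \<le> a * U_3_4 B + b * U_1_2_12 B"
      if "A \<subseteq> B" for A B
      using \<open>0 \<le> a\<close> \<open>0 \<le> b\<close> that by (intro add_mono mult_left_mono mU mU')
    ultimately show ?thesis
      unfolding Gamma4_def face_point_def
      by (simp add: distrib_left add.assoc add.left_commute U_3_4_def[of "{}"] U_1_2_12_def[of "{}"])
  qed
  then show ?thesis by (auto simp: face_def)
qed

lemma Gamma4_sum_in_face:
  assumes x: "x \<in> Gamma4" and y: "y \<in> Gamma4"
    and xy: "(\<lambda>A. x A + y A) \<in> face U_3_4 U_1_2_12"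
  shows "x \<in> face U_3_4 U_1_2_12"
proof -
  obtain a b where s: "\<And>A. x A + y A = a * U_3_4 A + b * U_1_2_12 A"
    using xy by (auto simp: face_def face_point_def fun_eq_iff)
  have U3: "U_3_4 {} = 0"
      "U_3_4 {1} = 1"
      "U_3_4 {2} = 1"
      "U_3_4 {3} = 1"
      "U_3_4 {4} = 1"
      "U_3_4 {1,2} = 2"
      "U_3_4 {1,3} = 2"
      "U_3_4 {1,4} = 2"
      "U_3_4 {2,3} = 2"
      "U_3_4 {2,4} = 2"
      "U_3_4 {3,4} = 2"
      "U_3_4 {1,2,3} = 3"
      "U_3_4 {1,2,4} = 3"
      "U_3_4 {1,3,4} = 3"
      "U_3_4 {2,3,4} = 3"
      "U_3_4 {1,2,3,4} = 3"
    by (simp_all add: U_3_4_def)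
  have U1: "U_1_2_12 {} = 0"
      "U_1_2_12 {1} = 1"
      "U_1_2_12 {2} = 1"
      "U_1_2_12 {3} = 0"
      "U_1_2_12 {4} = 0"
      "U_1_2_12 {1,2} = 1"
      "U_1_2_12 {1,3} = 1"
      "U_1_2_12 {1,4} = 1"
      "U_1_2_12 {2,3} = 1"
      "U_1_2_12 {2,4} = 1"
      "U_1_2_12 {3,4} = 0"
      "U_1_2_12 {1,2,3} = 1"
      "U_1_2_12 {1,2,4} = 1"
      "U_1_2_12 {1,3,4} = 1"
      "U_1_2_12 {2,3,4} = 1"
      "U_1_2_12 {1,2,3,4} = 1"
    by (simp_all add: U_1_2_12_def Int_insert_left)
  note U = U3 U1
  have sm: "h (A \<union> B) + h (A \<inter> B) \<le> h A + h B" if "h \<in> Gamma4" for h A B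
    using that by (simp add: Gamma4_def)
  have tight: "x C + x D = x A + x B"
    if "A \<union> B = C" "A \<inter> B = D"
       "a * U_3_4 C + b * U_1_2_12 C + (a * U_3_4 D + b * U_1_2_12 D) =
        a * U_3_4 A + b * U_1_2_12 A + (a * U_3_4 B + b * U_1_2_12 B)" for A B C D
    using sm[OF x, of A B] sm[OF y, of A B] s[of A] s[of B] s[of C] s[of D] that(3)
    unfolding that(1,2) by linarith
  have mono: "h A \<le> h B" if "h \<in> Gamma4" "A \<subseteq> B" for h A B
    using that by (simp add: Gamma4_def)
  have tight': "x A = x B"
    if "A \<subseteq> B" "a * U_3_4 A + b * U_1_2_12 A = a * U_3_4 B + b * U_1_2_12 B" for A B
    using mono[OF x, of A B] mono[OF y, of A B] s[of A] s[of B] that by linarith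
  have x0: "x {} = 0" using x by (simp add: Gamma4_def)
  have full: "x {1,2,3} = x {1,2,3,4}" "x {1,2,4} = x {1,2,3,4}" "x {1,3,4} = x {1,2,3,4}"
      "x {2,3,4} = x {1,2,3,4}"
    by (rule tight'; simp add: U)+
  have pairs: "x {1,3} = x {1} + x {3}" "x {1,4} = x {1} + x {4}" "x {2,3} = x {2} + x {3}"
      "x {2,4} = x {2} + x {4}" "x {3,4} = x {3} + x {4}"
    using tight[of "{3}" "{1}" "{1,3}" "{}"] tight[of "{4}" "{1}" "{1,4}" "{}"]
      tight[of "{3}" "{2}" "{2,3}" "{}"] tight[of "{4}" "{2}" "{2,4}" "{}"]
      tight[of "{4}" "{3}" "{3,4}" "{}"] x0
    by (simp_all add: U add.commute)
  have triples: "x {1,3,4} = x {1,3} + x {4}" "x {2,3,4} = x {2,3} + x {4}"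
      "x {1,2,3} = x {1,2} + x {3}" "x {1,2,4} = x {1,2} + x {4}"
    using tight[of "{4}" "{1,3}" "{1,3,4}" "{}"] tight[of "{4}" "{2,3}" "{2,3,4}" "{}"]
      tight[of "{3}" "{1,2}" "{1,2,3}" "{}"] tight[of "{4}" "{1,2}" "{1,2,4}" "{}"] x0
    by (simp_all add: U add.commute)
  have nn: "0 \<le> x {3}" using mono[OF x, of "{}" "{3}"] x0 by simp
  have le: "x {1,2} \<le> x {1} + x {2}"
    using sm[OF x, of "{2}" "{1}"] x0 by simp
  have eqs: "x {4} = x {3}" "x {2} = x {1}" "x {1,2} = x {1} + x {3}"
    by (insert full pairs triples, linarith+)
  have nn': "0 \<le> x {1} - x {3}" using le eqs by linarith
  have top: "x {1,2,3,4} = x {1} + 2 * x {3}"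
    using full(1) triples(3) eqs by linarith
  have vals: "x {} = x {3} * U_3_4 {} + (x {1} - x {3}) * U_1_2_12 {}"
      "x {1} = x {3} * U_3_4 {1} + (x {1} - x {3}) * U_1_2_12 {1}"
      "x {2} = x {3} * U_3_4 {2} + (x {1} - x {3}) * U_1_2_12 {2}"
      "x {3} = x {3} * U_3_4 {3} + (x {1} - x {3}) * U_1_2_12 {3}"
      "x {4} = x {3} * U_3_4 {4} + (x {1} - x {3}) * U_1_2_12 {4}"
      "x {1,2} = x {3} * U_3_4 {1,2} + (x {1} - x {3}) * U_1_2_12 {1,2}"
      "x {1,3} = x {3} * U_3_4 {1,3} + (x {1} - x {3}) * U_1_2_12 {1,3}"
      "x {1,4} = x {3} * U_3_4 {1,4} + (x {1} - x {3}) * U_1_2_12 {1,4}"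
      "x {2,3} = x {3} * U_3_4 {2,3} + (x {1} - x {3}) * U_1_2_12 {2,3}"
      "x {2,4} = x {3} * U_3_4 {2,4} + (x {1} - x {3}) * U_1_2_12 {2,4}"
      "x {3,4} = x {3} * U_3_4 {3,4} + (x {1} - x {3}) * U_1_2_12 {3,4}"
      "x {1,2,3} = x {3} * U_3_4 {1,2,3} + (x {1} - x {3}) * U_1_2_12 {1,2,3}"
      "x {1,2,4} = x {3} * U_3_4 {1,2,4} + (x {1} - x {3}) * U_1_2_12 {1,2,4}"
      "x {1,3,4} = x {3} * U_3_4 {1,3,4} + (x {1} - x {3}) * U_1_2_12 {1,3,4}"
      "x {2,3,4} = x {3} * U_3_4 {2,3,4} + (x {1} - x {3}) * U_1_2_12 {2,3,4}"
      "x {1,2,3,4} = x {3} * U_3_4 {1,2,3,4} + (x {1} - x {3}) * U_1_2_12 {1,2,3,4}"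
    by (simp_all only: U full top pairs eqs x0) (simp_all add: algebra_simps)
  have "x A = x {3} * U_3_4 A + (x {1} - x {3}) * U_1_2_12 A" for A
    by (fact subset_4_cases[where
        P = "\<lambda>A. x A = x {3} * U_3_4 A + (x {1} - x {3}) * U_1_2_12 A", OF vals])
  then have "x = face_point U_3_4 U_1_2_12 (x {3}) (x {1} - x {3})"
    unfolding face_point_def by (rule ext)
  then show ?thesis using nn nn' unfolding face_def by blast
qed

end

theory Submission
  imports Defs "HOL-Real_Asymp.Real_Asymp"
begin

text \<open>
  Suppose \<open>(a, b)\<close> is realised by \<open>X\<^sub>1, \<dots>, X\<^sub>4\<close>, and let \<open>x\<close> have positive probability. The entropies
  say that \<open>X\<^sub>1, X\<^sub>3, X\<^sub>4\<close> are mutually independent, that \<open>(X\<^sub>1, X\<^sub>2)\<close> is independent of \<open>X\<^sub>3\<close> and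
  of \<open>X\<^sub>4\<close>, and that any three of the variables determine the fourth. Hence
  \<open>p(x\<^sub>1) p(x\<^sub>3) p(x\<^sub>4) = p(x\<^sub>1, x\<^sub>2, x\<^sub>3, x\<^sub>4) = p(x\<^sub>1, x\<^sub>2) p(x\<^sub>4)\<close>, so that \<open>p(x\<^sub>3) = p(x\<^sub>1, x\<^sub>2) / p(x\<^sub>1)\<close>.
  Since every value of \<open>X\<^sub>3\<close> is compatible with a fixed pair \<open>(x\<^sub>1, x\<^sub>2)\<close>, \<open>X\<^sub>3\<close> is uniform on its
  support, whence \<open>a = H(X\<^sub>3)\<close> is the logarithm of an integer.

  Conversely, for \<open>a = log v\<close> take a uniform vector of four residues mod \<open>v\<close> with sum 0 and append to
  its first two entries a common independent variable of entropy \<open>b\<close>.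
\<close>

section \<open>Shannon entropy as a finite sum over outcomes\<close>

text \<open>The term of each value \<open>y\<close> of \<open>g \<circ> Z\<close> is distributed
  over the values of \<open>Z\<close> that \<open>g\<close> sends to \<open>y\<close>. The entropies
  of all subvectors thus become averages over the same joint outcomes, and only the argument of the
  logarithm depends on \<open>g\<close>.\<close>

lemma (in information_space) entropy_comp_eq_sum:
  assumes Z: "simple_function M Z"
  shows "\<H>(g \<circ> Z) = - (\<Sum>z\<in>Z ` space M. prob (Z -` {z} \<inter> space M) *
           log b (\<Sum>z' | z' \<in> Z ` space M \<and> g z' = g z. prob (Z -` {z'} \<inter> space M)))"
proof -
  let ?V = "Z ` space M"
  have fin: "finite ?V" using Z by (rule simple_functionD)
  have ev: "Z -` {z} \<inter> space M \<in> events" for z using Z by (rule simple_functionD)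
  have prob_comp: "prob ((g \<circ> Z) -` {y} \<inter> space M)
      = (\<Sum>z | z \<in> ?V \<and> g z = y. prob (Z -` {z} \<inter> space M))" for y
  proof -
    have "(g \<circ> Z) -` {y} \<inter> space M = (\<Union>z\<in>{z \<in> ?V. g z = y}. Z -` {z} \<inter> space M)"
      by auto
    moreover have "prob (\<Union>z\<in>{z \<in> ?V. g z = y}. Z -` {z} \<inter> space M)
        = (\<Sum>z | z \<in> ?V \<and> g z = y. prob (Z -` {z} \<inter> space M))"
      using fin ev by (intro finite_measure_finite_Union) (auto simp: disjoint_family_on_def)
    ultimately show ?thesis by (rule trans[OF arg_cong[where f=prob]])
  qed
  note gZ = simple_function_compose[OF Z, of g]
  have "\<H>(g \<circ> Z) = - (\<Sum>y\<in>g ` ?V. prob ((g \<circ> Z) -` {y} \<inter> space M) *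
      log b (prob ((g \<circ> Z) -` {y} \<inter> space M)))"
    by (subst entropy_simple_distributed[OF simple_distributedI[OF gZ measure_nonneg refl]])
       (simp only: image_comp)
  also have "(\<Sum>y\<in>g ` ?V. prob ((g \<circ> Z) -` {y} \<inter> space M) *
      log b (prob ((g \<circ> Z) -` {y} \<inter> space M)))
    = (\<Sum>y\<in>g ` ?V. \<Sum>z | z \<in> ?V \<and> g z = y. prob (Z -` {z} \<inter> space M) *
      log b (prob ((g \<circ> Z) -` {g z} \<inter> space M)))"
    by (intro sum.cong refl) (subst prob_comp, simp add: sum_distrib_right)
  also have "\<dots> = (\<Sum>z\<in>?V. prob (Z -` {z} \<inter> space M) *
      log b (prob ((g \<circ> Z) -` {g z} \<inter> space M)))"
    using fin by (rule sum.image_gen[symmetric])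
  finally show ?thesis by (simp only: prob_comp)
qed

locale finite_random_vector =
  fixes \<Omega> :: "'w set" and p :: "'w \<Rightarrow> real" and X :: "'i \<Rightarrow> 'w \<Rightarrow> 'v"
  assumes finite_\<Omega>: "finite \<Omega>"
    and p_nonneg: "\<And>x. x \<in> \<Omega> \<Longrightarrow> 0 \<le> p x"
    and sum_p: "sum p \<Omega> = 1"
begin

definition fibre :: "'i set \<Rightarrow> 'w \<Rightarrow> 'w set" where
  "fibre A x = {y \<in> \<Omega>. \<forall>i\<in>A. X i y = X i x}"

text \<open>As a function of the outcome rather than of the value of the subvector, marginals for
  different index sets can be multiplied and compared pointwise.\<close>

definition marginal :: "'i set \<Rightarrow> 'w \<Rightarrow> real" where
  "marginal A x = sum p (fibre A x)"

text \<open>Shannon entropy as the mean of minus the log-marginal. A marginal can vanish only at an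
  outcome of weight 0, whose term is 0.\<close>

definition ent :: "'i set \<Rightarrow> real" where
  "ent A = - (\<Sum>x\<in>\<Omega>. p x * log 2 (marginal A x))"

lemma finite_fibre: "finite (fibre A x)"
  using finite_\<Omega> by (simp add: fibre_def)

lemma fibre_subset: "fibre A x \<subseteq> \<Omega>"
  by (auto simp: fibre_def)

lemma sum_if_mem: "S \<subseteq> \<Omega> \<Longrightarrow> (\<Sum>x\<in>\<Omega>. if x \<in> S then f x else (0 :: real)) = sum f S"
  using finite_\<Omega> by (simp add: sum.If_cases Int_absorb1)

lemma fibre_cong: "(\<And>i. i \<in> A \<Longrightarrow> X i x = X i y) \<Longrightarrow> fibre A x = fibre A y"
  by (auto simp: fibre_def)

lemma marginal_cong: "(\<And>i. i \<in> A \<Longrightarrow> X i x = X i y) \<Longrightarrow> marginal A x = marginal A y"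
  unfolding marginal_def by (metis fibre_cong)

lemma marginal_antimono: "A \<subseteq> B \<Longrightarrow> marginal B x \<le> marginal A x"
  unfolding marginal_def
  by (intro sum_mono2 finite_fibre) (auto simp: fibre_def p_nonneg)

end

lemma entropic_ent:
  assumes "finite_random_vector \<Omega> p"
  shows "entropic (finite_random_vector.ent \<Omega> p X)"
proof -
  interpret F: finite_random_vector \<Omega> p X by fact
  define M where "M = point_measure \<Omega> (\<lambda>x. ennreal (p x))"
  have sp: "space M = \<Omega>" by (simp add: M_def space_point_measure)
  have prob: "measure M S = sum p S" if "S \<subseteq> \<Omega>" for S
  proof -
    have "emeasure M S = (\<Sum>x\<in>S. ennreal (p x))"
      unfolding M_def by (rule emeasure_point_measure_finite[OF F.finite_\<Omega> that])
    also have "\<dots> = ennreal (sum p S)"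
      using that F.p_nonneg by (intro sum_ennreal) auto
    finally show ?thesis
      using that F.p_nonneg by (subst measure_def) (auto intro!: enn2real_ennreal sum_nonneg)
  qed
  have "emeasure M (space M) = ennreal (sum p \<Omega>)"
    unfolding sp unfolding M_def
    by (simp add: emeasure_point_measure_finite F.finite_\<Omega> sum_ennreal F.p_nonneg)
  then have ps: "prob_space M" using F.sum_p by (intro prob_spaceI) simp
  interpret information_space M 2
    using ps by (simp add: information_space_def information_space_axioms_def)
  have sf: "simple_function M g" for g :: "'a \<Rightarrow> 'z"
    unfolding M_def using F.finite_\<Omega> by simp
  show ?thesis
  proof (rule entropicI[OF ps, of X])
    show "simple_function M (X i)" for i by (rule sf)
    fix A
    have eq: "subvector X A y = subvector X A x \<longleftrightarrow> (\<forall>i\<in>A. X i y = X i x)" for x y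
      by (auto simp: subvector_def fun_eq_iff)
    \<comment> \<open>Composing with \<open>id\<close> makes the outcome itself the underlying
      variable \<open>Z\<close> of \<open>entropy_comp_eq_sum\<close>.\<close>
    have "entropy 2 (count_space ((subvector X A \<circ> id) ` space M)) (subvector X A \<circ> id)
        = - (\<Sum>x\<in>\<Omega>. p x * log 2 (\<Sum>y | y \<in> \<Omega> \<and> subvector X A y = subvector X A x. p y))"
      unfolding entropy_comp_eq_sum[OF sf]
      by (simp add: sp prob)
    then show "F.ent A = entropy 2 (count_space (subvector X A ` space M)) (subvector X A)"
      unfolding comp_id by (simp add: F.ent_def F.marginal_def F.fibre_def eq)
  qed
qed

text \<open>Passing to the joint distribution makes the outcomes the value vectors themselves and
  the variables coordinate projections. Vectors of probability 0 are dropped, which changes no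
  marginal and no entropy.\<close>

lemma entropic_imp_ent:
  assumes "entropic h"
  obtains \<Omega> :: "(4 \<Rightarrow> nat) set" and p where "finite_random_vector \<Omega> p" "\<And>x. x \<in> \<Omega> \<Longrightarrow> 0 < p x"
    "h = finite_random_vector.ent \<Omega> p (\<lambda>i x. x i)"
proof -
  obtain M and X :: "4 \<Rightarrow> nat \<Rightarrow> nat" where ps: "prob_space M" and X: "\<And>i. simple_function M (X i)"
    and h: "\<And>A. h A = prob_space.entropy M 2 (count_space (subvector X A ` space M)) (subvector X A)"
    using assms unfolding entropic_def by blast
  interpret information_space M 2
    using ps by (simp add: information_space_def information_space_axioms_def)
  define Z where "Z = subvector X UNIV"
  have Z: "simple_function M Z" unfolding Z_def by (rule simple_function_subvector[OF X])
  define p where "p z = prob (Z -` {z} \<inter> space M)" for z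
  define \<Omega> where "\<Omega> = {z \<in> Z ` space M. 0 < p z}"
  have fin: "finite (Z ` space M)" using Z by (rule simple_functionD)
  have drop: "sum f \<Omega> = sum f (Z ` space M)" if "\<And>z. p z = 0 \<Longrightarrow> f z = 0" for f :: "_ \<Rightarrow> real"
    unfolding \<Omega>_def using that fin
    by (intro sum.mono_neutral_left) (auto simp: p_def zero_less_measure_iff)
  have "sum p \<Omega> = sum p (Z ` space M)" by (rule drop)
  also have "\<dots> = prob (\<Union>z\<in>Z ` space M. Z -` {z} \<inter> space M)"
    unfolding p_def using fin simple_functionD[OF Z]
    by (intro finite_measure_finite_Union[symmetric]) (auto simp: disjoint_family_on_def)
  also have "(\<Union>z\<in>Z ` space M. Z -` {z} \<inter> space M) = space M" by auto
  finally have F: "finite_random_vector \<Omega> p"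
    using fin by unfold_locales (auto simp: \<Omega>_def prob_space)
  interpret F: finite_random_vector \<Omega> p "\<lambda>i x. x i" by fact
  have "h A = F.ent A" for A
  proof -
    have sub: "subvector X A = (\<lambda>z. restrict z A) \<circ> Z"
      by (auto simp: Z_def subvector_def fun_eq_iff)
    have eq: "restrict y A = restrict x A \<longleftrightarrow> (\<forall>i\<in>A. y i = x i)" for x y :: "4 \<Rightarrow> nat"
      by (auto simp: fun_eq_iff)
    have marg: "(\<Sum>y | y \<in> Z ` space M \<and> restrict y A = restrict x A. p y) = F.marginal A x" for x
      unfolding F.marginal_def F.fibre_def eq using fin
      by (intro sum.mono_neutral_right) (auto simp: \<Omega>_def p_def zero_less_measure_iff)
    have "h A = - (\<Sum>x\<in>Z ` space M. p x * log 2 (F.marginal A x))"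
      unfolding h sub entropy_comp_eq_sum[OF Z] p_def[symmetric] marg ..
    then show ?thesis unfolding F.ent_def by (subst drop) auto
  qed
  then show ?thesis using that[OF F] by (auto simp: \<Omega>_def fun_eq_iff)
qed

section \<open>Pointwise consequences of entropy identities\<close>

locale positive_random_vector = finite_random_vector +
  assumes p_pos: "\<And>x. x \<in> \<Omega> \<Longrightarrow> 0 < p x"
begin

lemma marginal_pos: "x \<in> \<Omega> \<Longrightarrow> 0 < marginal A x"
  unfolding marginal_def by (intro sum_pos2[of _ x] finite_fibre) (auto simp: fibre_def p_pos p_nonneg)

text \<open>\<open>ent B - ent A\<close> is the mean of the logarithm of
  \<open>marginal A / marginal B\<close>, which is nonnegative by monotonicity. If the mean is 0, it
  vanishes at every outcome because all weights are positive.\<close>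

lemma marginal_eq_if_ent_eq:
  assumes "A \<subseteq> B" "ent A = ent B" "x \<in> \<Omega>"
  shows "marginal A x = marginal B x"
proof -
  let ?d = "\<lambda>x. p x * (log 2 (marginal A x) - log 2 (marginal B x))"
  have nonneg: "0 \<le> ?d y" if "y \<in> \<Omega>" for y
    using that marginal_antimono[OF assms(1)] marginal_pos p_nonneg by simp
  have "sum ?d \<Omega> = 0"
    using assms(2) by (simp add: ent_def algebra_simps sum_subtractf)
  then have "?d x = 0"
    using nonneg assms(3) finite_\<Omega> by (simp add: sum_nonneg_eq_0_iff)
  then show ?thesis
    using p_pos[OF assms(3)] marginal_pos[OF assms(3)]
    by (simp add: log_def)
qed

lemma sum_fibre_inverse_marginal: "x \<in> \<Omega> \<Longrightarrow> (\<Sum>y\<in>fibre A x. p y / marginal A y) = 1"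
proof -
  assume x: "x \<in> \<Omega>"
  have "(\<Sum>y\<in>fibre A x. p y / marginal A y) = (\<Sum>y\<in>fibre A x. p y / marginal A x)"
    by (intro sum.cong refl arg_cong2[where f="(/)"] marginal_cong) (auto simp: fibre_def)
  also have "\<dots> = marginal A x / marginal A x"
    by (simp add: marginal_def flip: sum_divide_distrib)
  finally show ?thesis using marginal_pos[OF x, of A] by simp
qed

text \<open>
  Equality case of Gibbs' inequality. The ratio \<open>marginal A * marginal B / marginal (A \<union> B)\<close> has
  expectation the total weight of the pairs \<open>(y, z)\<close> that can be glued to one outcome, hence at
  most 1; as its logarithm has mean 0, it equals 1 everywhere and all pairs can be glued.
\<close>

lemma
  assumes ent: "ent (A \<union> B) = ent A + ent B"
  shows marginal_Un: "x \<in> \<Omega> \<Longrightarrow> marginal (A \<union> B) x = marginal A x * marginal B x"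
    and glue: "y \<in> \<Omega> \<Longrightarrow> z \<in> \<Omega> \<Longrightarrow> fibre A y \<inter> fibre B z \<noteq> {}"
proof -
  define t where "t x = marginal A x * marginal B x / marginal (A \<union> B) x" for x
  have t_pos: "0 < t x" if "x \<in> \<Omega>" for x
    using marginal_pos[OF that] by (simp add: t_def)
  \<comment> \<open>A nonempty intersection is a single fibre of \<open>A \<union> B\<close>, on
    which the normalised weights sum to 1. So this sum is the indicator that \<open>y\<close> and
    \<open>z\<close> can be glued.\<close>
  have ind: "(\<Sum>x\<in>fibre A y \<inter> fibre B z. p x / marginal (A \<union> B) x)
      = (if fibre A y \<inter> fibre B z = {} then 0 else 1)" for y z
  proof (cases "fibre A y \<inter> fibre B z = {}")
    case False
    then obtain u where u: "u \<in> fibre A y" "u \<in> fibre B z" by auto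
    then have "fibre A y \<inter> fibre B z = fibre (A \<union> B) u"
      by (auto simp: fibre_def)
    moreover have "u \<in> \<Omega>" using u by (simp add: fibre_def)
    ultimately show ?thesis using False sum_fibre_inverse_marginal by simp
  qed simp
  have sym: "x \<in> fibre A y \<inter> fibre B z \<longleftrightarrow> y \<in> fibre A x \<and> z \<in> fibre B x"
    if "x \<in> \<Omega>" "y \<in> \<Omega>" "z \<in> \<Omega>" for x y z
    using that by (auto simp: fibre_def)
  \<comment> \<open>Double counting of the triples in which \<open>x\<close> agrees with
    \<open>y\<close> on \<open>A\<close> and with \<open>z\<close> on \<open>B\<close>: the sum over
    \<open>x\<close> is moved innermost, where \<open>ind\<close> evaluates it.\<close>
  have "(\<Sum>x\<in>\<Omega>. p x * t x)
      = (\<Sum>x\<in>\<Omega>. \<Sum>y\<in>fibre A x. \<Sum>z\<in>fibre B x. p y * p z * (p x / marginal (A \<union> B) x))"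
  proof (rule sum.cong[OF refl])
    fix x
    have "p x * t x = marginal A x * marginal B x * (p x / marginal (A \<union> B) x)"
      by (simp add: t_def)
    also have "marginal A x * marginal B x = (\<Sum>y\<in>fibre A x. \<Sum>z\<in>fibre B x. p y * p z)"
      by (simp only: marginal_def sum_product)
    finally show "p x * t x
        = (\<Sum>y\<in>fibre A x. \<Sum>z\<in>fibre B x. p y * p z * (p x / marginal (A \<union> B) x))"
      by (simp only: sum_distrib_right)
  qed
  also have "\<dots> = (\<Sum>x\<in>\<Omega>. \<Sum>y\<in>\<Omega>. \<Sum>z\<in>\<Omega>.
      if x \<in> fibre A y \<inter> fibre B z then p y * p z * (p x / marginal (A \<union> B) x) else 0)"
  proof (rule sum.cong[OF refl])
    fix x assume x: "x \<in> \<Omega>"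
    have "(\<Sum>y\<in>fibre A x. \<Sum>z\<in>fibre B x. p y * p z * (p x / marginal (A \<union> B) x))
      = (\<Sum>y\<in>\<Omega>. if y \<in> fibre A x
          then \<Sum>z\<in>\<Omega>. if z \<in> fibre B x then p y * p z * (p x / marginal (A \<union> B) x) else 0 else 0)"
      by (simp only: sum_if_mem fibre_subset)
    also have "\<dots> = (\<Sum>y\<in>\<Omega>. \<Sum>z\<in>\<Omega>.
      if x \<in> fibre A y \<inter> fibre B z then p y * p z * (p x / marginal (A \<union> B) x) else 0)"
      by (intro sum.cong refl) (use x sym in \<open>auto intro!: sum.cong sum.neutral[symmetric]\<close>)
    finally show "(\<Sum>y\<in>fibre A x. \<Sum>z\<in>fibre B x. p y * p z * (p x / marginal (A \<union> B) x)) = \<dots>" .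
  qed
  also have "\<dots> = (\<Sum>y\<in>\<Omega>. \<Sum>x\<in>\<Omega>. \<Sum>z\<in>\<Omega>.
      if x \<in> fibre A y \<inter> fibre B z then p y * p z * (p x / marginal (A \<union> B) x) else 0)"
    by (rule sum.swap)
  also have "\<dots> = (\<Sum>y\<in>\<Omega>. \<Sum>z\<in>\<Omega>. \<Sum>x\<in>\<Omega>.
      if x \<in> fibre A y \<inter> fibre B z then p y * p z * (p x / marginal (A \<union> B) x) else 0)"
    by (intro sum.cong refl sum.swap)
  also have "\<dots> = (\<Sum>y\<in>\<Omega>. \<Sum>z\<in>\<Omega>. p y * p z * (if fibre A y \<inter> fibre B z = {} then 0 else 1))"
  proof (intro sum.cong refl)
    fix y z
    have "fibre A y \<inter> fibre B z \<subseteq> \<Omega>"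
      using fibre_subset by blast
    then have "(\<Sum>x\<in>\<Omega>. if x \<in> fibre A y \<inter> fibre B z then p y * p z * (p x / marginal (A \<union> B) x) else 0)
        = (\<Sum>x\<in>fibre A y \<inter> fibre B z. p y * p z * (p x / marginal (A \<union> B) x))"
      by (rule sum_if_mem)
    also have "\<dots> = p y * p z * (\<Sum>x\<in>fibre A y \<inter> fibre B z. p x / marginal (A \<union> B) x)"
      by (rule sum_distrib_left[symmetric])
    finally show "(\<Sum>x\<in>\<Omega>. if x \<in> fibre A y \<inter> fibre B z then p y * p z * (p x / marginal (A \<union> B) x) else 0)
        = p y * p z * (if fibre A y \<inter> fibre B z = {} then 0 else 1)"
      by (simp only: ind)
  qed
  finally have expect: "(\<Sum>x\<in>\<Omega>. p x * t x)
      = (\<Sum>y\<in>\<Omega>. \<Sum>z\<in>\<Omega>. p y * p z * (if fibre A y \<inter> fibre B z = {} then 0 else 1))" .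
  \<comment> \<open>The weight of the pairs that cannot be glued; its total is the deficit of the
    mean of \<open>t\<close> from 1.\<close>
  define gap where "gap y z = p y * p z * (if fibre A y \<inter> fibre B z = {} then 1 else 0)" for y z
  have gap_nonneg: "0 \<le> gap y z" if "y \<in> \<Omega>" "z \<in> \<Omega>" for y z
    using that p_nonneg by (simp add: gap_def)
  have "(\<Sum>y\<in>\<Omega>. \<Sum>z\<in>\<Omega>. gap y z) + (\<Sum>x\<in>\<Omega>. p x * t x) = (\<Sum>y\<in>\<Omega>. \<Sum>z\<in>\<Omega>. p y * p z)"
    unfolding expect gap_def sum.distrib[symmetric] by (intro sum.cong refl) simp
  then have total: "(\<Sum>y\<in>\<Omega>. \<Sum>z\<in>\<Omega>. gap y z) + (\<Sum>x\<in>\<Omega>. p x * t x) = 1"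
    by (simp add: sum_p flip: sum_product)
  \<comment> \<open>The weighted error in \<open>ln t \<le> t - 1\<close>. Once the mean of
    \<open>ln t\<close> is 0, the total slack is the mean of \<open>t\<close> minus 1, that is,
    minus the total gap, so both totals vanish.\<close>
  define slack where "slack x = p x * (t x - 1 - ln (t x))" for x
  have slack_nonneg: "0 \<le> slack x" if "x \<in> \<Omega>" for x
    using that p_nonneg ln_le_minus_one[OF t_pos[OF that]] by (simp add: slack_def)
  have "(\<Sum>x\<in>\<Omega>. p x * ln (t x)) = 0"
  proof -
    have "(\<Sum>x\<in>\<Omega>. p x * ln (t x)) / ln 2
        = (\<Sum>x\<in>\<Omega>. p x * (log 2 (marginal A x) + log 2 (marginal B x) - log 2 (marginal (A \<union> B) x)))"
      unfolding sum_divide_distrib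
    proof (rule sum.cong[OF refl])
      fix x assume "x \<in> \<Omega>"
      note pos = marginal_pos[OF this]
      show "p x * ln (t x) / ln 2
          = p x * (log 2 (marginal A x) + log 2 (marginal B x) - log 2 (marginal (A \<union> B) x))"
        using pos[of A] pos[of B] pos[of "A \<union> B"]
        by (simp add: t_def log_def ln_mult ln_div diff_divide_distrib add_divide_distrib[symmetric])
           (simp add: field_simps)
    qed
    also have "\<dots> = ent (A \<union> B) - ent A - ent B"
      by (simp add: ent_def algebra_simps sum_subtractf sum.distrib)
    finally show ?thesis using ent by simp
  qed
  then have "(\<Sum>x\<in>\<Omega>. slack x) + (\<Sum>y\<in>\<Omega>. \<Sum>z\<in>\<Omega>. gap y z) = 0"
    using total sum_p by (simp add: slack_def right_diff_distrib sum_subtractf)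
  moreover have "0 \<le> (\<Sum>x\<in>\<Omega>. slack x)" "0 \<le> (\<Sum>y\<in>\<Omega>. \<Sum>z\<in>\<Omega>. gap y z)"
    by (auto intro!: sum_nonneg slack_nonneg gap_nonneg)
  ultimately have zero: "(\<Sum>x\<in>\<Omega>. slack x) = 0" "(\<Sum>y\<in>\<Omega>. \<Sum>z\<in>\<Omega>. gap y z) = 0"
    by linarith+
  show "marginal (A \<union> B) x = marginal A x * marginal B x" if x: "x \<in> \<Omega>"
  proof -
    have "slack x = 0"
      using zero(1) x slack_nonneg finite_\<Omega> by (simp add: sum_nonneg_eq_0_iff)
    then have "ln (t x) = t x - 1" using p_pos[OF x] by (simp add: slack_def)
    then have "t x = 1" using ln_eq_minus_one t_pos[OF x] by blast
    then show ?thesis using marginal_pos[OF x, of "A \<union> B"] by (simp add: t_def field_simps)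
  qed
  show "fibre A y \<inter> fibre B z \<noteq> {}" if y: "y \<in> \<Omega>" and z: "z \<in> \<Omega>"
  proof
    assume "fibre A y \<inter> fibre B z = {}"
    then have "0 < gap y z" using p_pos y z by (simp add: gap_def)
    moreover have "gap y z = 0"
      using zero(2) y z gap_nonneg finite_\<Omega> by (simp add: sum_nonneg_eq_0_iff sum_nonneg)
    ultimately show False by simp
  qed
qed

text \<open>The constant \<open>c\<close> is the probability of every value of \<open>X i\<close>.
  These probabilities sum to 1, so \<open>c\<close> is the inverse of the number of values.\<close>

lemma ent_singleton_if_marginal_const:
  assumes const: "\<And>x. x \<in> \<Omega> \<Longrightarrow> marginal {i} x = c"
  shows "ent {i} = log 2 (real (card (X i ` \<Omega>)))"
proof -
  have "1 = (\<Sum>t\<in>X i ` \<Omega>. \<Sum>x | x \<in> \<Omega> \<and> X i x = t. p x)"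
    using sum_p sum.image_gen[OF finite_\<Omega>, of p "X i"] by simp
  also have "\<dots> = (\<Sum>t\<in>X i ` \<Omega>. c)"
    using const by (intro sum.cong refl) (auto simp: marginal_def fibre_def)
  finally have c: "real (card (X i ` \<Omega>)) * c = 1" by simp
  have "ent {i} = - (\<Sum>x\<in>\<Omega>. p x * log 2 c)"
    using const by (simp add: ent_def)
  also have "\<dots> = - log 2 c" by (simp add: sum_p flip: sum_distrib_right)
  also have "c = inverse (real (card (X i ` \<Omega>)))"
    using c by (metis inverse_unique)
  finally show ?thesis by (simp only: log_inverse minus_minus)
qed

end

section \<open>Realising the points with \<open>a = log 2 v\<close>\<close>

text \<open>Put mass \<open>s\<close> on one value and spread the rest evenly over \<open>m\<close>
  others. The entropy is continuous in \<open>s\<close>, is 0 at \<open>s = 1\<close> and is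
  \<open>log 2 m\<close> at \<open>s = 0\<close>, so the intermediate value theorem applies.\<close>

lemma exists_distribution_with_entropy:
  assumes "0 \<le> b"
  shows "\<exists>(m::nat) p. (\<forall>z. 0 \<le> p z) \<and> sum p {..m} = 1 \<and> - (\<Sum>z\<le>m. p z * log 2 (p z)) = b"
proof -
  \<comment> \<open>Large enough that \<open>log 2 m \<ge> b\<close>.\<close>
  define m where "m = nat \<lceil>2 powr b\<rceil>"
  have m: "2 powr b \<le> real m" unfolding m_def by linarith
  then have m_pos: "0 < real m" by (rule less_le_trans[rotated]) simp
  define P where "P s z = (if z = 0 then s else (1 - s) / real m)" for s :: real and z :: nat
  have split: "(\<Sum>z\<le>m. f (P s z)) = f s + real m * f ((1 - s) / real m)" for f :: "real \<Rightarrow> real" and s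
  proof -
    have "{..m} = insert 0 {1..m}" by auto
    then show ?thesis by (simp add: P_def)
  qed
  \<comment> \<open>At 0 the value of \<open>x * log 2 x\<close> is 0, which is also its limit from
    the right, so the endpoint is included.\<close>
  have cont: "continuous_on {0..} (\<lambda>x::real. x * log 2 x)"
  proof (rule continuous_on_eq_continuous_within[THEN iffD2], intro ballI)
    fix x :: real assume "x \<in> {0..}"
    show "continuous (at x within {0..}) (\<lambda>x. x * log 2 x)"
    proof (cases "x = 0")
      case True
      have "((\<lambda>x::real. x * log 2 x) \<longlongrightarrow> 0) (at_right 0)"
        unfolding log_def by real_asymp
      moreover have "at (0::real) within {0..} = at_right 0"
        by (rule at_within_nhd[of _ UNIV]) auto
      ultimately show ?thesis using True by (simp add: continuous_within)
    next
      case False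
      with \<open>x \<in> {0..}\<close> show ?thesis
        by (intro continuous_intros) auto
    qed
  qed
  define H where "H s = - (\<Sum>z\<le>m. P s z * log 2 (P s z))" for s
  have H_eq: "H = (\<lambda>s. - (s * log 2 s + real m * ((1 - s) / real m * log 2 ((1 - s) / real m))))"
    unfolding H_def by (rule ext) (simp only: split[of "\<lambda>x. x * log 2 x"])
  have "continuous_on {0..1} (\<lambda>s. (\<lambda>x. x * log 2 x) s)"
    by (rule continuous_on_subset[OF cont]) auto
  moreover have "continuous_on {0..1} (\<lambda>s. (\<lambda>x. x * log 2 x) ((1 - s) / real m))"
    by (rule continuous_on_compose2[OF cont]) (use m_pos in \<open>auto intro!: continuous_intros\<close>)
  ultimately have "continuous_on {0..1} H"
    unfolding H_eq by (intro continuous_on_minus continuous_on_add continuous_on_mult_left)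
  moreover have "H 1 = 0" unfolding H_eq by simp
  moreover have "b \<le> H 0"
  proof -
    have "b = log 2 (2 powr b)" by simp
    also have "\<dots> \<le> log 2 (real m)" using m m_pos by (subst log_le_cancel_iff) auto
    also have "\<dots> = H 0" unfolding H_eq using m_pos by (simp add: log_divide)
    finally show ?thesis .
  qed
  ultimately obtain s where s: "0 \<le> s" "s \<le> 1" "H s = b"
    using IVT2'[of H 1 b 0] assms by auto
  have "sum (P s) {..m} = 1" using split[of "\<lambda>x. x" s] m_pos by simp
  moreover have "0 \<le> P s z" for z using s by (simp add: P_def)
  ultimately show ?thesis using s(3) unfolding H_def by blast
qed

text \<open>Vectors of residues mod \<open>v\<close>, represented by naturals below
  \<open>v\<close>, with sum 0. All coordinates but one are free and determine the last, as in a
  uniform matroid of rank one less than the size of its ground set.\<close>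

definition zero_sum :: "nat \<Rightarrow> ('i::finite \<Rightarrow> nat) set" where
  "zero_sum v = {x. (\<forall>i. x i < v) \<and> v dvd sum x UNIV}"

lemma finite_zero_sum: "finite (zero_sum v)"
proof -
  have "zero_sum v \<subseteq> UNIV \<rightarrow>\<^sub>E {..<v}" by (auto simp: zero_sum_def)
  then show ?thesis by (rule finite_subset) (simp add: finite_PiE)
qed

text \<open>If \<open>A\<close> misses an index \<open>j\<close>, the entries outside
  \<open>A\<close> and \<open>j\<close> can be chosen freely and the sum condition then determines
  the entry at \<open>j\<close>.\<close>

lemma card_zero_sum_fixed:
  fixes c :: "'i::finite \<Rightarrow> nat"
  assumes c: "c \<in> zero_sum v"
  shows "card {x \<in> zero_sum v. \<forall>i\<in>A. x i = c i} = v ^ (CARD('i) - 1 - card A)"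
\<comment> \<open>For \<open>A = UNIV\<close> the truncated exponent is 0, matching the single
  vector \<open>c\<close>.\<close>
proof (cases "A = UNIV")
  case True
  then have "{x \<in> zero_sum v. \<forall>i\<in>A. x i = c i} = {c}" using c by auto
  then show ?thesis using True by simp
next
  case False
  then obtain j where j: "j \<notin> A" by auto
  define S where "S = {x \<in> zero_sum v. \<forall>i\<in>A. x i = c i}"
  define B where "B = - insert j A"
  have v: "0 < v" using c by (auto simp: zero_sum_def)
  have sum_split: "sum x UNIV = x j + sum x (- {j})" for x :: "'i \<Rightarrow> nat"
    by (simp add: sum.remove[of UNIV j] Compl_eq_Diff_UNIV)
  have "inj_on (\<lambda>x. restrict x B) S"
  proof (rule inj_onI)
    fix x y assume x: "x \<in> S" and y: "y \<in> S" and eq: "restrict x B = restrict y B"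
    have off: "x i = y i" if "i \<noteq> j" for i
      using x y that fun_cong[OF eq, of i] by (cases "i \<in> A") (auto simp: S_def B_def)
    have tail: "sum x (- {j}) = sum y (- {j})"
      by (intro sum.cong) (auto simp: off)
    have "v dvd x j + sum y (- {j})" "v dvd y j + sum y (- {j})"
      using x y sum_split[of x] sum_split[of y] tail by (simp_all add: S_def zero_sum_def)
    moreover have "x j < v" "y j < v" using x y by (auto simp: S_def zero_sum_def)
    \<comment> \<open>Congruent residues below \<open>v\<close> are equal: the truncated difference
      \<open>a - b\<close> is a multiple of \<open>v\<close> below \<open>v\<close>, hence 0.
      Applied in both directions.\<close>
    moreover have "a \<le> b" if "v dvd a + k" "v dvd b + k" "a < v" for a b k
    proof -
      have "v dvd a - b" using dvd_diff_nat[OF that(1,2)] by simp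
      then show ?thesis using \<open>a < v\<close> by (auto dest: dvd_imp_le)
    qed
    ultimately have "x j = y j" by (blast intro: antisym)
    with off show "x = y" by (metis ext)
  qed
  moreover have "(\<lambda>x. restrict x B) ` S = B \<rightarrow>\<^sub>E {..<v}"
  proof (intro equalityI subsetI)
    fix g assume g: "g \<in> B \<rightarrow>\<^sub>E {..<v}"
    define x0 where "x0 i = (if i \<in> A then c i else g i)" for i
    \<comment> \<open>The entry at \<open>j\<close> cancels the sum of the others; the outer
      \<open>mod\<close> turns \<open>v\<close> into 0 when that sum is already a multiple of
      \<open>v\<close>.\<close>
    define x where "x = x0(j := (v - sum x0 (- {j}) mod v) mod v)"
    have tail: "sum x (- {j}) = sum x0 (- {j})" by (intro sum.cong) (auto simp: x_def)
    have "sum x UNIV mod v = (v - sum x0 (- {j}) mod v + sum x0 (- {j}) mod v) mod v"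
      unfolding sum_split tail by (simp only: x_def fun_upd_same mod_add_left_eq mod_add_right_eq)
    also have "\<dots> = 0" using mod_less_divisor[OF v, of "sum x0 (- {j})"] by simp
    finally have "v dvd sum x UNIV" by (simp add: dvd_eq_mod_eq_0)
    moreover have "x i < v" for i
      using g c v by (auto simp: x_def x0_def B_def zero_sum_def PiE_def Pi_def)
    ultimately have "x \<in> S" using j by (auto simp: S_def zero_sum_def x_def x0_def)
    moreover have "g = restrict x B"
      using g by (auto simp: fun_eq_iff x_def x0_def B_def PiE_def extensional_def)
    ultimately show "g \<in> (\<lambda>x. restrict x B) ` S" by blast
  qed (auto simp: S_def zero_sum_def)
  ultimately have "card S = card (B \<rightarrow>\<^sub>E {..<v})"
    by (metis card_image)
  also have "\<dots> = v ^ card B" by (simp add: card_PiE)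
  also have "card B = CARD('i) - 1 - card A"
    using j by (simp add: B_def Compl_eq_Diff_UNIV card_Diff_subset)
  finally show ?thesis unfolding S_def .
qed

lemma entropic_face_point:
  assumes v: "1 \<le> v" and b: "0 \<le> b"
  shows "entropic (face_point U_3_4 U_1_2_12 (log 2 (real v)) b)"
proof -
  obtain m :: nat and p where p_nonneg: "\<And>z. 0 \<le> p z" and sum_p: "sum p {..m} = 1"
    and ent_p: "- (\<Sum>z\<le>m. p z * log 2 (p z)) = b"
    using exists_distribution_with_entropy[OF b] by blast
  let ?Z = "zero_sum v :: (4 \<Rightarrow> nat) set"
  define \<Omega> where "\<Omega> = ?Z \<times> {..m}"
  \<comment> \<open>A uniform vector among the \<open>v ^ 3\<close> zero-sum ones, independent of
    \<open>z\<close>.\<close>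
  define w where "w = (\<lambda>(x :: 4 \<Rightarrow> nat, z). p z / real v ^ 3)"
  \<comment> \<open>The constant second entry 0 for indices 3 and 4 carries no information and gives
    all four variables the same value type.\<close>
  define X where "X i = (\<lambda>(x :: 4 \<Rightarrow> nat, z :: nat). (x i, if i \<in> {1, 2} then z else 0))" for i
  have w_pair: "w (x, z) = p z / real v ^ 3" for x z by (simp add: w_def)
  have card_Z: "card ?Z = v ^ 3"
    using card_zero_sum_fixed[of "\<lambda>_::4. 0" v "{}"] v by (simp add: zero_sum_def)
  have F: "finite_random_vector \<Omega> w"
  proof
    show "finite \<Omega>" by (simp add: \<Omega>_def finite_zero_sum)
    show "0 \<le> w x" for x by (auto simp: w_def p_nonneg split: prod.split)
    show "sum w \<Omega> = 1"
      using v by (simp add: \<Omega>_def w_def card_Z sum_p flip: sum.cartesian_product sum_divide_distrib)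
  qed
  interpret F: finite_random_vector \<Omega> w X by (rule F)
  have "F.ent A = face_point U_3_4 U_1_2_12 (log 2 (real v)) b A" for A
  proof -
    \<comment> \<open>\<open>k\<close> counts the free residues seen by \<open>A\<close>, and
      \<open>q\<close> is the marginal of \<open>z\<close> seen by \<open>A\<close>: it is 1 when
      neither of the variables 1 and 2 is observed.\<close>
    define k where "k = min 3 (card A)"
    define q where "q z = (if A \<inter> {1, 2} = {} then 1 else p z)" for z
    have marg: "F.marginal A (x, z) = q z / real v ^ k" if x: "x \<in> ?Z" and z: "z \<le> m" for x z
    proof -
      have "F.fibre A (x, z) = {y \<in> ?Z. \<forall>i\<in>A. y i = x i} \<times> (if A \<inter> {1, 2} = {} then {..m} else {z})"
        unfolding F.fibre_def using z by (auto simp: \<Omega>_def X_def split: if_splits)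
      then have "F.marginal A (x, z) = real (v ^ (3 - card A)) * q z / real v ^ 3"
        unfolding F.marginal_def
        by (simp add: w_def q_def card_zero_sum_fixed[OF x] sum_p
            flip: sum.cartesian_product sum_divide_distrib)
      also have "3 - card A = 3 - k" by (simp add: k_def)
      also have "real (v ^ (3 - k)) = real v ^ 3 / real v ^ k"
        using v power_diff[of "real v" k 3] by (simp add: k_def)
      finally show ?thesis using v by simp
    qed
    have "F.ent A = - (\<Sum>(x, z)\<in>?Z \<times> {..m}. p z / real v ^ 3 * log 2 (q z / real v ^ k))"
      unfolding F.ent_def
      by (intro arg_cong[where f=uminus] sum.cong) (simp add: \<Omega>_def, auto simp: w_pair marg)
    also have "\<dots> = - (\<Sum>x\<in>?Z. \<Sum>z\<le>m. p z / real v ^ 3 * log 2 (q z / real v ^ k))"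
      by (simp only: sum.cartesian_product)
    also have "\<dots> = - (\<Sum>z\<le>m. p z * log 2 (q z / real v ^ k))"
      using v by (simp add: card_Z sum_distrib_left)
    also have "\<dots> = - (\<Sum>z\<le>m. p z * log 2 (q z) - p z * (real k * log 2 (real v)))"
    \<comment> \<open>If \<open>p z = 0\<close>, the logarithm of the quotient need not split
      because \<open>q z\<close> may be 0; both sides then vanish through the factor
      \<open>p z\<close>.\<close>
    proof (intro arg_cong[where f=uminus] sum.cong refl)
      fix z
      show "p z * log 2 (q z / real v ^ k) = p z * log 2 (q z) - p z * (real k * log 2 (real v))"
        using v p_nonneg[of z]
        by (cases "p z = 0") (auto simp: q_def log_divide log_nat_power right_diff_distrib)
    qed
    also have "\<dots> = real k * log 2 (real v) - (\<Sum>z\<le>m. p z * log 2 (q z))"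
      by (simp add: sum_subtractf sum_p flip: sum_distrib_right)
    also have "- (\<Sum>z\<le>m. p z * log 2 (q z)) = b * U_1_2_12 A"
    proof (cases "A \<inter> {1, 2} = {}")
      case False
      then have "0 < card (A \<inter> {1, 2})" by (simp add: card_gt_0_iff)
      then have "min 1 (card (A \<inter> {1, 2})) = 1" by simp
      moreover have "q = p" using False by (auto simp: q_def fun_eq_iff)
      ultimately show ?thesis using ent_p by (simp add: U_1_2_12_def)
    qed (simp add: q_def U_1_2_12_def)
    then have "real k * log 2 (real v) - (\<Sum>z\<le>m. p z * log 2 (q z)) =
        log 2 (real v) * U_3_4 A + b * U_1_2_12 A"
      by (simp add: k_def U_3_4_def)
    finally show ?thesis by (simp add: face_point_def)
  qed
  then have "F.ent = face_point U_3_4 U_1_2_12 (log 2 (real v)) b" by (rule ext)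
  with entropic_ent[OF F, of X] show ?thesis by simp
qed

section \<open>Necessity: \<open>a\<close> is the logarithm of an integer\<close>

lemma entropic_face_point_imp:
  assumes "entropic (face_point U_3_4 U_1_2_12 a b)"
  shows "\<exists>v::nat. 1 \<le> v \<and> a = log 2 (real v)"
proof -
  obtain \<Omega> :: "(4 \<Rightarrow> nat) set" and p where F: "finite_random_vector \<Omega> p"
    and pos: "\<And>x. x \<in> \<Omega> \<Longrightarrow> 0 < p x"
    and h: "face_point U_3_4 U_1_2_12 a b = finite_random_vector.ent \<Omega> p (\<lambda>i x. x i)"
    using entropic_imp_ent[OF assms] by metis
  interpret positive_random_vector \<Omega> p "\<lambda>i x. x i"
    using F pos by (simp add: positive_random_vector_def positive_random_vector_axioms_def)
  have ent: "ent A = a * U_3_4 A + b * U_1_2_12 A" for A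
    by (simp add: h[symmetric] face_point_def)
  note U = ent U_3_4_def U_1_2_12_def Int_insert_left
  \<comment> \<open>In both matroids the ranks add for these disjoint sets, and both triples below
    have full rank, so the identities hold for all \<open>a\<close> and \<open>b\<close>. Element 3
    has rank 0 in \<open>U_1_2_12\<close>, which leaves \<open>a\<close> as its entropy.\<close>
  have e13: "ent ({1} \<union> {3}) = ent {1} + ent {3}"
    and e134: "ent ({1, 3} \<union> {4}) = ent {1, 3} + ent {4}"
    and e123: "ent ({1, 2} \<union> {3}) = ent {1, 2} + ent {3}"
    and e124: "ent ({1, 2} \<union> {4}) = ent {1, 2} + ent {4}"
    and f134: "ent {1, 3, 4} = ent {1, 2, 3, 4}"
    and f124: "ent {1, 2, 4} = ent {1, 2, 3, 4}"
    and e3: "ent {3} = a"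
    by (simp_all add: U algebra_simps)
  \<comment> \<open>Both triples have the full joint probability; factoring them in two ways lets
    the marginal of the fourth variable cancel.\<close>
  have quotient: "marginal {3} z = marginal {1, 2} z / marginal {1} z" if z: "z \<in> \<Omega>" for z
  proof -
    have "marginal {1, 3, 4} z = marginal {1, 2, 4} z"
      using marginal_eq_if_ent_eq[OF _ f134 z] marginal_eq_if_ent_eq[OF _ f124 z] by auto
    then have "marginal {1} z * marginal {3} z * marginal {4} z = marginal {1, 2} z * marginal {4} z"
      using marginal_Un[OF e13 z] marginal_Un[OF e134 z] marginal_Un[OF e124 z]
      by (simp add: insert_commute)
    then show ?thesis
      using marginal_pos[OF z, of "{1}"] marginal_pos[OF z, of "{4}"] by (simp add: field_simps)
  qed
  have "\<Omega> \<noteq> {}" using sum_p by auto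
  then obtain x where x: "x \<in> \<Omega>" by auto
  have "marginal {3} y = marginal {3} x" if y: "y \<in> \<Omega>" for y
  proof -
    \<comment> \<open>The glued outcome takes its third entry from \<open>y\<close> but its first
      two from \<open>x\<close>, so the quotient formula gives it the value found at
      \<open>x\<close>.\<close>
    obtain z where z: "z \<in> fibre {1, 2} x" "z \<in> fibre {3} y"
      using glue[OF e123 x y] by auto
    then have "z \<in> \<Omega>" by (simp add: fibre_def)
    have "marginal {3} y = marginal {3} z"
      using z(2) by (intro marginal_cong) (simp add: fibre_def)
    also have "\<dots> = marginal {1, 2} z / marginal {1} z" by (rule quotient) fact
    also have "marginal {1, 2} z = marginal {1, 2} x"
      using z(1) by (intro marginal_cong) (auto simp: fibre_def)
    also have "marginal {1} z = marginal {1} x"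
      using z(1) by (intro marginal_cong) (auto simp: fibre_def)
    also have "marginal {1, 2} x / marginal {1} x = marginal {3} x"
      using quotient[OF x] by simp
    finally show ?thesis .
  qed
  from ent_singleton_if_marginal_const[OF this]
  have "a = log 2 (real (card ((\<lambda>x. x 3) ` \<Omega>)))" using e3 by simp
  moreover have "1 \<le> card ((\<lambda>x. x 3) ` \<Omega>)"
    using \<open>\<Omega> \<noteq> {}\<close> finite_\<Omega> by (simp add: Suc_le_eq card_gt_0_iff)
  ultimately show ?thesis by blast
qed

theorem mainTheorem14:
  fixes a b :: real
  assumes "0 \<le> a" and "0 \<le> b"
  shows "entropic (face_point U_3_4 U_1_2_12 a b) \<longleftrightarrow>
           (\<exists>v::nat. v \<ge> 1 \<and> a = log 2 (real v))"
  using entropic_face_point_imp entropic_face_point[OF _ assms(2)] by blast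

end
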